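(* The Deutsch–Jozsa problem is solvable in the class $\mathrm{MQ}^2$ (with oracle access to $f$). Precisely: for every $n$ and every function $f:\{0,1\}^n\to\{0,1\}$ that is promised to be either constant or balanced (i.e. $f$ takes the value $1$ on exactly $2^{n-1}$ inputs), there exist a unitary $2^n\times 2^n$ matrix $T$ whose entries $\langle y|T|x\rangle$ (indexed by $x,y\in\{0,1\}^n$) are computable in time polynomial in $n$ using one query to $f$, an initial basis vector $|I\rangle$ and a polynomial-time computable set of accepting basis states $A\subseteq\{0,1\}^n$, all given uniformly in $n$, such that $$\sum_{c\in A}\left|\langle c|T^2|I\rangle\right|^2 \ \ge\ \tfrac{2}{3} \text{ if } f \text{ is constant},\qquad \sum_{c\in A}\left|\langle c|T^2|I\rangle\right|^2 \ \le\ \tfrac{1}{3} \text{ if } f \text{ is balanced}.$$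
   Context: Notation: $\langle i|M|j\rangle$ denotes the entry of a matrix $M$ in row $i$, column $j$. A sequence of square matrices $T_1,T_2,\dots$ is a poly-computable matrix family if there is a function $F(i,j,n)=\langle j|T_n|i\rangle$ computable in time polynomial in the bit-lengths of $i,j,n$. The class $\mathrm{MQ}^2$: a language $L$ is in $\mathrm{MQ}^2$ iff there exist a poly-computable family $(T_n)$ of unitary matrices, a poly-computable family of vectors $I(x)$ (entries computable in polynomial time), and a polynomial-time computable function $a(x,c)\in\{0,1\}$ such that for every input $x$ of length $n$: if $x\in L$ then $\sum_{c:\,a(x,c)=1}|\langle c|T_n^2|I(x)\rangle|^2\ge 2/3$, and if $x\notin L$ then this sum is $\le 1/3$. In the Deutsch–Jozsa setting, $f$ is accessed as an oracle, so the entry-computing function may query $f$; the task is to distinguish constant $f$ from balanced $f$. *)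

theory Defs
  imports
    "HOL-Computational_Algebra.Polynomial"
    "Jordan_Normal_Form.Schur_Decomposition"
begin

section \<open>Oracle Turing machines\<close>

text \<open>
  Deterministic multi-tape machines over the tape alphabet \<open>{0, 1, blank}\<close> with one-way infinite
  tapes. \<open>None\<close> is the blank symbol.
\<close>

type_synonym symbol = "bool option"

datatype dir = MoveL | Stay | MoveR

text \<open>
  \<open>Act s ws\<close> writes and moves on all tapes and enters state \<open>s\<close>. \<open>Ask i s1 s0\<close> submits the string
  stored on tape \<open>i\<close> to the oracle and enters \<open>s1\<close> or \<open>s0\<close> according to the answer.
\<close>

datatype action = Halt | Act nat "(symbol \<times> dir) list" | Ask nat nat nat

record machine =
  num_tapes :: nat
  num_states :: nat
  delta :: "nat \<Rightarrow> symbol list \<Rightarrow> action"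

text \<open>
  Well-formedness makes the control finite: the transition function matters only on the finitely
  many pairs of a state below \<open>num_states\<close> and a list of \<open>num_tapes\<close> scanned symbols.
\<close>

definition well_formed :: "machine \<Rightarrow> bool" where
  "well_formed M \<longleftrightarrow> 0 < num_states M \<and>
     (\<forall>s < num_states M. \<forall>as. length as = num_tapes M \<longrightarrow>
        (case delta M s as of
           Halt \<Rightarrow> True
         | Act s' ws \<Rightarrow> s' < num_states M \<and> length ws = num_tapes M
         | Ask i s1 s0 \<Rightarrow> i < num_tapes M \<and> s1 < num_states M \<and> s0 < num_states M))"

type_synonym tape = "(nat \<Rightarrow> symbol) \<times> nat"

type_synonym config = "nat \<times> tape list \<times> nat"
  \<comment> \<open>state, tapes (contents and head position), number of oracle queries so far\<close>

fun scan :: "tape \<Rightarrow> symbol" where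
  "scan (g, h) = g h"

fun write_move :: "symbol \<times> dir \<Rightarrow> tape \<Rightarrow> tape" where
  "write_move (a, d) (g, h) =
     (g(h := a), case d of MoveL \<Rightarrow> h - 1 | Stay \<Rightarrow> h | MoveR \<Rightarrow> h + 1)"

definition load :: "bool list \<Rightarrow> tape" where
  "load w = (\<lambda>i. if i < length w then Some (w ! i) else None, 0)"

text \<open>The string on a tape extends from cell 0 to the first blank, wherever the head is.\<close>

definition content :: "tape \<Rightarrow> bool list" where
  "content tp = map (the \<circ> fst tp) [0..<(LEAST i. fst tp i = None)]"

fun step :: "machine \<Rightarrow> (bool list \<Rightarrow> bool) \<Rightarrow> config \<Rightarrow> config" where
  "step M f (s, ts, q) =
     (case delta M s (map scan ts) of
        Halt \<Rightarrow> (s, ts, q)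
      | Act s' ws \<Rightarrow> (s', map2 write_move ws ts, q)
      | Ask i s1 s0 \<Rightarrow> (if f (content (ts ! i)) then s1 else s0, ts, Suc q))"

text \<open>
  \<open>computes M f ws vs t q\<close>: started in state 0 with the inputs \<open>ws\<close> on the first tapes and all
  other tapes blank, \<open>M\<close> with oracle \<open>f\<close> has halted after \<open>t\<close> steps, having made exactly \<open>q\<close> oracle
  queries, and the outputs \<open>vs\<close> are on the tapes directly following the input tapes.
\<close>

definition computes ::
  "machine \<Rightarrow> (bool list \<Rightarrow> bool) \<Rightarrow> bool list list \<Rightarrow> bool list list \<Rightarrow> nat \<Rightarrow> nat \<Rightarrow> bool"
where
  "computes M f ws vs t q \<longleftrightarrow>
     length ws + length vs \<le> num_tapes M \<and>
     (\<exists>s ts.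
        (step M f ^^ t) (0, map load ws @ replicate (num_tapes M - length ws) (load []), 0)
          = (s, ts, q) \<and>
        delta M s (map scan ts) = Halt \<and>
        map content (take (length vs) (drop (length ws) ts)) = vs)"


section \<open>Polynomial-time computability\<close>

definition bits :: "nat \<Rightarrow> bool list set" where
  "bits n = {w. length w = n}"

definition poly_time_strings :: "(nat \<Rightarrow> bool list) \<Rightarrow> bool" where
  "poly_time_strings w \<longleftrightarrow>
     (\<exists>M (p :: nat poly). well_formed M \<and>
        (\<forall>n. \<exists>t \<le> poly p n. computes M (\<lambda>_. False) [replicate n True] [w n] t 0))"

definition poly_time_sets :: "(nat \<Rightarrow> bool list set) \<Rightarrow> bool" where
  "poly_time_sets A \<longleftrightarrow>
     (\<exists>M (p :: nat poly). well_formed M \<and>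
        (\<forall>n. \<forall>c \<in> bits n. \<exists>t \<le> poly p n. computes M (\<lambda>_. False) [c] [[c \<in> A n]] t 0))"

text \<open>The position of a bit string in the computational basis, least significant bit first.\<close>

definition idx :: "bool list \<Rightarrow> nat" where
  "idx w = horner_sum of_bool 2 w"

definition entry :: "bool list \<Rightarrow> complex mat \<Rightarrow> bool list \<Rightarrow> complex" where
  "entry y T x = T $$ (idx y, idx x)"

text \<open>Integers are output as a sign bit followed by the magnitude, least significant bit first.\<close>

fun signed_int :: "bool list \<Rightarrow> int" where
  "signed_int [] = 0"
| "signed_int (s # bs) = (if s then - 1 else 1) * horner_sum of_bool 2 bs"

text \<open>
  Matrix entries are complex numbers, so computing them is meant in the usual sense: given the row
  \<open>y\<close>, the column \<open>x\<close> and a precision \<open>k\<close> in unary, output numerators of dyadic approximations of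
  the real and the imaginary part up to \<open>2^-k\<close>, in time polynomial in \<open>n\<close> and \<open>k\<close>. Each such run
  makes exactly one query to \<open>f\<close>.
\<close>

definition computes_entries ::
  "machine \<Rightarrow> nat poly \<Rightarrow> nat \<Rightarrow> (bool list \<Rightarrow> bool) \<Rightarrow> complex mat \<Rightarrow> bool"
where
  "computes_entries M p n f T \<longleftrightarrow>
     (\<forall>y \<in> bits n. \<forall>x \<in> bits n. \<forall>k.
        \<exists>a b. \<exists>t \<le> poly p (n + k).
          computes M f [y, x, replicate k True] [a, b] t 1 \<and>
          \<bar>Re (entry y T x) - of_int (signed_int a) / 2 ^ k\<bar> \<le> 1 / 2 ^ k \<and>
          \<bar>Im (entry y T x) - of_int (signed_int b) / 2 ^ k\<bar> \<le> 1 / 2 ^ k)"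


section \<open>Unitary matrices and the promise\<close>

definition unitary :: "nat \<Rightarrow> complex mat \<Rightarrow> bool" where
  "unitary N T \<longleftrightarrow> T \<in> carrier_mat N N \<and>
     mat_adjoint T * T = 1\<^sub>m N \<and> T * mat_adjoint T = 1\<^sub>m N"

text \<open>A function on bit strings of length \<open>n\<close> is given by its values on \<open>bits n\<close> only.\<close>

definition is_constant :: "nat \<Rightarrow> (bool list \<Rightarrow> bool) \<Rightarrow> bool" where
  "is_constant n f \<longleftrightarrow> (\<exists>b. \<forall>x \<in> bits n. f x = b)"

text \<open>
  For \<open>n = 0\<close> no function is balanced; the guard excludes the truncated exponent \<open>0 - 1 = 0\<close>.
\<close>

definition is_balanced :: "nat \<Rightarrow> (bool list \<Rightarrow> bool) \<Rightarrow> bool" where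
  "is_balanced n f \<longleftrightarrow> 1 \<le> n \<and> card {x \<in> bits n. f x} = 2 ^ (n - 1)"

end

theory Submission
  imports Defs
begin

text \<open>
  Take \<open>T = D H\<close>, where \<open>D\<close> is the diagonal matrix of the signs \<open>(-1)^f y\<close> and \<open>H\<close> is the
  \<open>n\<close>-fold Hadamard matrix up to a global phase. An entry of \<open>T\<close> needs only the value \<open>f y\<close> at its
  row, and the corner entry of \<open>T\<^sup>2 = D H D H\<close> is, up to phase, the Deutsch-Jozsa amplitude: the
  mean of all the signs, which has modulus \<open>1\<close> for constant \<open>f\<close> and \<open>0\<close> for balanced \<open>f\<close>. So the
  all-zero string serves both as the initial and as the only accepting state.
\<close>

section \<open>Strings on tapes\<close>

text \<open>Every tape in the runs below is a string from cell 0 followed by blanks: each write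
  repeats the scanned symbol or appends at the first blank.\<close>

definition tape_of :: "bool list \<Rightarrow> nat \<Rightarrow> tape" where
  "tape_of w h = (fst (load w), h)"

lemma load_eq_tape_of: "load w = tape_of w 0"
  by (simp add: tape_of_def load_def)

lemma scan_tape_of [simp]:
  "scan (tape_of w h) = (if h < length w then Some (w ! h) else None)"
  by (simp add: tape_of_def load_def)

lemma content_tape_of [simp]: "content (tape_of w h) = w"
proof -
  have "(LEAST i. fst (tape_of w h) i = None) = length w"
    by (rule Least_equality) (auto simp: tape_of_def load_def split: if_splits)
  then show ?thesis
    by (auto simp: content_def tape_of_def load_def intro!: nth_equalityI)
qed

lemma write_move_keep:
  "a = scan (tape_of w h) \<Longrightarrow> write_move (a, d) (tape_of w h) =
     tape_of w (case d of MoveL \<Rightarrow> h - 1 | Stay \<Rightarrow> h | MoveR \<Rightarrow> h + 1)"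
  by (auto simp: tape_of_def load_def)

lemma write_move_append:
  "h = length w \<Longrightarrow> write_move (Some b, MoveR) (tape_of w h) = tape_of (w @ [b]) (Suc h)"
  by (auto simp: tape_of_def load_def nth_append)

lemma funpow_step_append:
  assumes "(step M f ^^ t) c = c'" and "(step M f ^^ u) c' = c''"
  shows "(step M f ^^ (t + u)) c = c''"
  using assms by (simp add: add.commute[of t] funpow_add)


section \<open>The initial state and the accepting set\<close>

definition zeros_delta :: "nat \<Rightarrow> symbol list \<Rightarrow> action" where
  "zeros_delta s as =
     (if as ! 0 = None then Halt else Act 0 [(as ! 0, MoveR), (Some False, MoveR)])"

definition zeros_machine :: machine where
  "zeros_machine = \<lparr>num_tapes = 2, num_states = 1, delta = zeros_delta\<rparr>"

lemma zeros_machine_run: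
  "j \<le> n \<Longrightarrow> (step zeros_machine f ^^ j) (0, [tape_of (replicate n True) 0, tape_of [] 0], 0)
     = (0, [tape_of (replicate n True) j, tape_of (replicate j False) j], 0)"
proof (induction j)
  case (Suc j)
  then show ?case
    by (simp add: zeros_machine_def zeros_delta_def write_move_keep write_move_append
        replicate_append_same)
qed simp

lemma poly_time_strings_zeros: "poly_time_strings (\<lambda>n. replicate n False)"
proof -
  have "well_formed zeros_machine"
    by (simp add: well_formed_def zeros_machine_def zeros_delta_def)
  moreover have "computes zeros_machine (\<lambda>_. False) [replicate n True] [replicate n False] n 0"
    for n
    using zeros_machine_run[of n n "\<lambda>_. False"]
    by (simp add: computes_def load_eq_tape_of)
       (simp add: zeros_machine_def zeros_delta_def load_eq_tape_of numeral_2_eq_2)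
  moreover have "n \<le> poly [:0, 1:] n" for n :: nat
    by simp
  ultimately show ?thesis
    unfolding poly_time_strings_def by blast
qed

text \<open>The first cell that does not hold a zero decides: the answer is whether it is blank,
  that is, past the end of the input.\<close>

definition all_zero_delta :: "nat \<Rightarrow> symbol list \<Rightarrow> action" where
  "all_zero_delta s as =
     (if s \<noteq> 0 then Halt
      else if as ! 0 = Some False then Act 0 [(as ! 0, MoveR), (as ! 1, Stay)]
      else Act 1 [(as ! 0, Stay), (Some (as ! 0 = None), MoveR)])"

definition all_zero_machine :: machine where
  "all_zero_machine = \<lparr>num_tapes = 2, num_states = 2, delta = all_zero_delta\<rparr>"

lemma all_zero_machine_run:
  assumes "j \<le> length c" and "\<And>i. i < j \<Longrightarrow> \<not> c ! i"
  shows "(step all_zero_machine f ^^ j) (0, [tape_of c 0, tape_of [] 0], 0)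
     = (0, [tape_of c j, tape_of [] 0], 0)"
  using assms
proof (induction j)
  case (Suc j)
  then show ?case
    by (simp add: all_zero_machine_def all_zero_delta_def write_move_keep)
qed simp

lemma computes_all_zero:
  "\<exists>t \<le> length c + 1.
     computes all_zero_machine f [c] [[c = replicate (length c) False]] t 0"
proof -
  define j where "j = length (takeWhile Not c)"
  have j: "j \<le> length c" "\<And>i. i < j \<Longrightarrow> \<not> c ! i"
    by (simp add: j_def length_takeWhile_le) (metis j_def nth_mem set_takeWhileD takeWhile_nth)
  have zero: "c = replicate (length c) False \<longleftrightarrow> j = length c"
  proof
    assume "c = replicate (length c) False"
    then show "j = length c"
      by (metis (full_types) in_set_replicate j_def takeWhile_eq_all_conv)
  next
    assume "j = length c"
    then show "c = replicate (length c) False"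
      using j(2) by (auto intro: nth_equalityI)
  qed
  have nz: "j < length c \<Longrightarrow> c ! j"
    using nth_length_takeWhile[of Not c] by (simp add: j_def)
  have "(step all_zero_machine f ^^ Suc j) (0, [tape_of c 0, tape_of [] 0], 0)
     = (1, [tape_of c j, tape_of [c = replicate (length c) False] 1], 0)"
    using nz j(1) all_zero_machine_run[OF j]
    by (simp add: zero) (auto simp: all_zero_machine_def all_zero_delta_def
          write_move_keep write_move_append)
  then have "computes all_zero_machine f [c] [[c = replicate (length c) False]] (Suc j) 0"
    by (simp add: computes_def load_eq_tape_of del: funpow.simps)
       (simp add: all_zero_machine_def all_zero_delta_def load_eq_tape_of numeral_2_eq_2
          del: funpow.simps)
  then show ?thesis
    using j(1) by (intro exI[of _ "Suc j"]) simp
qed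

lemma poly_time_sets_zeros: "poly_time_sets (\<lambda>n. {replicate n False})"
proof -
  have "well_formed all_zero_machine"
    by (simp add: well_formed_def all_zero_machine_def all_zero_delta_def)
  moreover have "\<exists>t \<le> poly [:1, 1:] n.
      computes all_zero_machine (\<lambda>_. False) [c] [[c \<in> {replicate n False}]] t 0"
    if "c \<in> bits n" for n c
    using computes_all_zero[of c] that by (simp add: bits_def)
  ultimately show ?thesis
    unfolding poly_time_sets_def by blast
qed


section \<open>Characters of the group of bit strings\<close>

text \<open>Inner product over the two-element field; the maps
  \<open>x \<mapsto> bsign (dot y x)\<close> are the characters.\<close>

fun dot :: "bool list \<Rightarrow> bool list \<Rightarrow> bool" where
  "dot (a # x) (b # y) = ((a \<and> b) \<noteq> dot x y)"
| "dot _ _ = False"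

definition bsign :: "bool \<Rightarrow> 'a :: comm_ring_1" where
  "bsign b = (if b then - 1 else 1)"

text \<open>The left-hand side is the simplifier's normal form of
  \<open>bsign (a \<noteq> b)\<close>.\<close>

lemma bsign_xor: "bsign (a = (\<not> b)) = bsign a * bsign b"
  by (simp add: bsign_def)

lemma bsign_squared [simp]: "bsign a * bsign a = 1"
  by (simp add: bsign_def)

text \<open>\<open>dot\<close> recurses from the front, whereas the machine extends a prefix; this
  serves its loop invariant.\<close>

lemma dot_snoc:
  "length x = length y \<Longrightarrow> dot (x @ [a]) (y @ [b]) = (dot x y \<noteq> (a \<and> b))"
  by (induction x y rule: list_induct2) auto

lemma dot_replicate_False [simp]:
  "dot (replicate n False) x = False" "dot x (replicate n False) = False"
proof -
  show "dot (replicate n False) x = False"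
    by (induction n arbitrary: x) (simp, case_tac x, auto)
  show "dot x (replicate n False) = False"
    by (induction n arbitrary: x; case_tac x) auto
qed

section \<open>Enumeration of bit strings and orthogonality of characters\<close>

lemma bits_0: "bits 0 = {[]}"
  by (auto simp: bits_def)

lemma bits_Suc: "bits (Suc n) = Cons False ` bits n \<union> Cons True ` bits n"
  by (auto simp: bits_def length_Suc_conv image_iff)

lemma finite_bits: "finite (bits n)"
  by (induction n) (auto simp: bits_0 bits_Suc)

lemma sum_bits_Suc:
  "(\<Sum>w\<in>bits (Suc n). g w) = (\<Sum>w\<in>bits n. g (False # w)) + (\<Sum>w\<in>bits n. g (True # w))"
  unfolding bits_Suc
  by (subst sum.union_disjoint) (auto simp: finite_bits sum.reindex)

lemma card_bits: "card (bits n) = 2 ^ n"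
proof (induction n)
  case (Suc n)
  then show ?case
    using sum_bits_Suc[of "\<lambda>_. 1 :: nat" n] by simp
qed (simp add: bits_0)

text \<open>Split on the first bit of \<open>z\<close>: the two halves agree if the first bits of
  \<open>x\<close> and \<open>y\<close> do, and cancel otherwise.\<close>

lemma sum_characters:
  "\<lbrakk>x \<in> bits n; y \<in> bits n\<rbrakk> \<Longrightarrow>
    (\<Sum>z\<in>bits n. bsign (dot x z) * bsign (dot y z))
      = (if x = y then 2 ^ n else 0 :: 'a :: comm_ring_1)"
proof (induction n arbitrary: x y)
  case 0
  then show ?case by (simp add: bits_0 bsign_def)
next
  case (Suc n)
  obtain a x' b y' where xy: "x = a # x'" "y = b # y'" "x' \<in> bits n" "y' \<in> bits n"
    using Suc.prems by (auto simp: bits_Suc)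
  have neg: "bsign (\<not> p) = - (bsign p :: 'a)" for p
    by (simp add: bsign_def)
  show ?case
    using Suc.IH[OF xy(3,4)]
    by (cases a; cases b) (auto simp: sum_bits_Suc xy(1,2) neg sum_negf)
qed

text \<open>The first bit is the parity of the index, so injectivity follows by induction;
  surjectivity follows by counting.\<close>

lemma bij_betw_idx: "bij_betw idx (bits n) {..<2 ^ n}"
proof (induction n)
  case 0
  then show ?case by (simp add: bits_0 idx_def bij_betw_def lessThan_Suc)
next
  case (Suc n)
  have idx: "idx (b # w) = of_bool b + 2 * idx w" for b w
    by (simp add: idx_def)
  have inj: "inj_on idx (bits (Suc n))"
  proof (rule inj_onI)
    fix v w assume vw: "v \<in> bits (Suc n)" "w \<in> bits (Suc n)" "idx v = idx w"
    obtain a v' b w' where *: "v = a # v'" "w = b # w'" "v' \<in> bits n" "w' \<in> bits n"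
      using vw by (auto simp: bits_Suc)
    have e: "of_bool a + 2 * idx v' = of_bool b + 2 * idx w'"
      using vw(3) by (simp add: * idx)
    have "a = b"
      using e by (cases a; cases b; simp; presburger)
    moreover have "v' = w'"
      using e * Suc \<open>a = b\<close> by (auto simp: bij_betw_def inj_on_def)
    ultimately show "v = w"
      by (simp add: *)
  qed
  have "idx ` bits (Suc n) \<subseteq> {..<2 ^ Suc n}"
  proof
    fix i assume "i \<in> idx ` bits (Suc n)"
    then obtain b w where w: "w \<in> bits n" "i = of_bool b + 2 * idx w"
      by (auto simp: bits_Suc idx simp del: of_bool_eq)
    have "idx w < 2 ^ n"
      using Suc w(1) by (auto simp: bij_betw_def)
    then show "i \<in> {..<2 ^ Suc n}"
      using w(2) by (cases b) auto
  qed
  then have "idx ` bits (Suc n) = {..<2 ^ Suc n}"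
    by (intro card_subset_eq) (simp_all only: card_image[OF inj] card_bits card_lessThan finite_lessThan)
  with inj show ?case
    by (simp add: bij_betw_def)
qed

lemma idx_less: "w \<in> bits n \<Longrightarrow> idx w < 2 ^ n"
  using bij_betw_idx[of n] by (auto simp: bij_betw_def)

lemma idx_inject: "\<lbrakk>v \<in> bits n; w \<in> bits n\<rbrakk> \<Longrightarrow> idx v = idx w \<longleftrightarrow> v = w"
  using bij_betw_idx[of n] by (auto simp: bij_betw_def inj_on_def)


section \<open>The unitary matrix\<close>

text \<open>
  For odd \<open>n\<close> the Hadamard matrix has irrational entries \<open>\<plusminus>2 powr (- n / 2)\<close>; the unimodular factor
  \<open>(1 + \<i>) / sqrt 2\<close> makes real and imaginary parts dyadic.
\<close>

definition amp :: "nat \<Rightarrow> complex" where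
  "amp n = (if odd n then 1 + \<i> else 1) / 2 ^ ((n + 1) div 2)"

definition dj_mat :: "nat \<Rightarrow> (bool list \<Rightarrow> bool) \<Rightarrow> complex mat" where
  "dj_mat n f = mat (2 ^ n) (2 ^ n) (\<lambda>(i, j).
     let y = the_inv_into (bits n) idx i; x = the_inv_into (bits n) idx j
     in bsign (f y \<noteq> dot y x) * amp n)"

lemma Re_amp: "Re (amp n) = 1 / 2 ^ ((n + 1) div 2)"
  and Im_amp: "Im (amp n) = (if odd n then 1 / 2 ^ ((n + 1) div 2) else 0)"
proof -
  have "amp n = (if odd n then 1 + \<i> else 1) / of_real (2 ^ ((n + 1) div 2))"
    by (simp add: amp_def)
  then show "Re (amp n) = 1 / 2 ^ ((n + 1) div 2)"
    and "Im (amp n) = (if odd n then 1 / 2 ^ ((n + 1) div 2) else 0)"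
    by (simp_all only: Re_divide_of_real Im_divide_of_real) simp_all
qed

text \<open>For odd \<open>n\<close>, the squared modulus 2 of \<open>1 + \<i>\<close> compensates
  for rounding the exponent up.\<close>

lemma amp_mult_cnj: "amp n * cnj (amp n) = 1 / 2 ^ n"
proof (cases "odd n")
  case True
  then obtain m where "n = 2 * m + 1" by (auto elim: oddE)
  then show ?thesis
    by (simp add: amp_def power_mult power2_eq_square algebra_simps flip: power_add power_mult mult_2)
next
  case False
  then obtain m where "n = 2 * m" by (auto elim: evenE)
  then show ?thesis
    by (simp add: amp_def flip: power_add mult_2)
qed

lemma cmod_amp: "(cmod (amp n))\<^sup>2 = 1 / 2 ^ n"
proof -
  have "complex_of_real ((cmod (amp n))\<^sup>2) = complex_of_real (1 / 2 ^ n)"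
    unfolding complex_norm_square amp_mult_cnj by simp
  then show ?thesis
    by (simp only: of_real_eq_iff)
qed

section \<open>Entries, products and unitarity\<close>

lemma entry_dj_mat:
  assumes "y \<in> bits n" "x \<in> bits n"
  shows "entry y (dj_mat n f) x = bsign (f y \<noteq> dot y x) * amp n"
  using assms bij_betw_idx[of n]
  by (simp add: entry_def dj_mat_def idx_less the_inv_into_f_f bij_betw_def)

lemma entry_mult:
  assumes "A \<in> carrier_mat (2 ^ n) (2 ^ n)" "B \<in> carrier_mat (2 ^ n) (2 ^ n)"
    and "y \<in> bits n" "x \<in> bits n"
  shows "entry y (A * B) x = (\<Sum>z\<in>bits n. entry y A z * entry z B x)"
proof -
  have "entry y (A * B) x = (\<Sum>k<2 ^ n. A $$ (idx y, k) * B $$ (k, idx x))"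
    using assms by (auto simp: entry_def scalar_prod_def idx_less atLeast0LessThan)
  also have "\<dots> = (\<Sum>z\<in>bits n. entry y A z * entry z B x)"
    unfolding entry_def by (rule sum.reindex_bij_betw[symmetric, OF bij_betw_idx])
  finally show ?thesis .
qed

lemma mat_eq_entryI:
  assumes "A \<in> carrier_mat (2 ^ n) (2 ^ n)" "B \<in> carrier_mat (2 ^ n) (2 ^ n)"
    and "\<And>y x. \<lbrakk>y \<in> bits n; x \<in> bits n\<rbrakk> \<Longrightarrow> entry y A x = entry y B x"
  shows "A = B"
proof (rule eq_matI)
  fix i j assume "i < dim_row B" "j < dim_col B"
  then have "i \<in> idx ` bits n" "j \<in> idx ` bits n"
    using assms(2) bij_betw_idx[of n] by (auto simp: bij_betw_def)
  then show "A $$ (i, j) = B $$ (i, j)"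
    using assms(3) by (auto simp: entry_def)
qed (use assms in auto)

text \<open>The signs of \<open>f\<close> factor out of the inner product of two rows, leaving
  character orthogonality. A right inverse of a square matrix is also a left inverse.\<close>

lemma unitary_dj_mat: "unitary (2 ^ n) (dj_mat n f)"
proof -
  let ?T = "dj_mat n f"
  have T: "?T \<in> carrier_mat (2 ^ n) (2 ^ n)"
    by (simp add: dj_mat_def)
  have adj: "mat_adjoint ?T \<in> carrier_mat (2 ^ n) (2 ^ n)"
    using T by (auto simp: mat_adjoint_def)
  have "?T * mat_adjoint ?T = 1\<^sub>m (2 ^ n)"
  proof (rule mat_eq_entryI)
    fix y x assume yx: "y \<in> bits n" "x \<in> bits n"
    have adj_entry: "entry z (mat_adjoint ?T) x = bsign (f x \<noteq> dot x z) * cnj (amp n)"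
      if "z \<in> bits n" for z
    proof -
      have "entry z (mat_adjoint ?T) x = cnj (entry x ?T z)"
        using carrier_matD[OF T] idx_less[OF that] idx_less[OF yx(2)]
        by (simp add: entry_def mat_adjoint_def mat_of_rows_index)
      then show ?thesis
        by (simp add: entry_dj_mat yx that bsign_def)
    qed
    have "entry y (?T * mat_adjoint ?T) x
        = (\<Sum>z\<in>bits n. bsign (f y \<noteq> dot y z) * amp n * (bsign (f x \<noteq> dot x z) * cnj (amp n)))"
      by (simp add: entry_mult[OF T adj yx] entry_dj_mat adj_entry yx)
    also have "\<dots> = bsign (f y) * bsign (f x) * (amp n * cnj (amp n)) *
        (\<Sum>z\<in>bits n. bsign (dot y z) * bsign (dot x z))"
      by (simp add: sum_distrib_left mult_ac bsign_xor)
    also have "\<dots> = (if y = x then 1 else 0)"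
      by (simp add: sum_characters[OF yx] amp_mult_cnj)
    also have "\<dots> = entry y (1\<^sub>m (2 ^ n)) x"
      using yx by (simp add: entry_def idx_less idx_inject[OF yx])
    finally show "entry y (?T * mat_adjoint ?T) x = entry y (1\<^sub>m (2 ^ n)) x" .
  qed (use T adj in auto)
  with mat_mult_left_right_inverse[OF T adj] T show ?thesis
    by (simp add: unitary_def)
qed

section \<open>The acceptance probability\<close>

lemma cmod_entry_dj_mat_squared:
  defines "z \<equiv> \<lambda>n. replicate n False"
  shows "(cmod (entry (z n) (dj_mat n f ^\<^sub>m 2) (z n)))\<^sup>2
    = ((\<Sum>x\<in>bits n. bsign (f x)) / 2 ^ n)\<^sup>2"
proof -
  have T: "dj_mat n f \<in> carrier_mat (2 ^ n) (2 ^ n)"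
    by (simp add: dj_mat_def)
  have z: "z n \<in> bits n"
    by (simp add: z_def bits_def)
  have "dj_mat n f ^\<^sub>m 2 = dj_mat n f * dj_mat n f"
    using T by (simp add: numeral_2_eq_2)
  \<comment> \<open>Both inner products with the zero string vanish, so only the signs of
    \<open>f\<close> survive.\<close>
  then have "entry (z n) (dj_mat n f ^\<^sub>m 2) (z n)
      = (\<Sum>x\<in>bits n. bsign (f (z n)) * amp n * (bsign (f x) * amp n))"
    using entry_mult[OF T T z z] z by (simp add: entry_dj_mat) (simp add: z_def)
  also have "\<dots> = bsign (f (z n)) * (amp n)\<^sup>2 * (\<Sum>x\<in>bits n. bsign (f x))"
    by (simp add: sum_distrib_left power2_eq_square mult_ac)
  \<comment> \<open>As the sum is real, its modulus is an absolute value, which disappears on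
    squaring.\<close>
  also have "(\<Sum>x\<in>bits n. bsign (f x)) = complex_of_real (\<Sum>x\<in>bits n. bsign (f x))"
    by (auto simp: bsign_def intro!: sum.cong)
  finally have "cmod (entry (z n) (dj_mat n f ^\<^sub>m 2) (z n))
      = \<bar>\<Sum>x\<in>bits n. bsign (f x)\<bar> / 2 ^ n"
    by (simp add: norm_mult norm_power cmod_amp bsign_def del: of_real_sum)
  then show ?thesis
    by (simp add: power_divide)
qed

lemma sum_sign_constant:
  assumes "is_constant n f"
  shows "(\<Sum>x\<in>bits n. bsign (f x) :: real)\<^sup>2 = (2 ^ n)\<^sup>2"
proof -
  obtain b where "\<forall>x\<in>bits n. f x = b"
    using assms by (auto simp: is_constant_def)
  then have "(\<Sum>x\<in>bits n. bsign (f x) :: real) = 2 ^ n * bsign b"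
    by (simp add: card_bits)
  then show ?thesis
    by (simp add: bsign_def)
qed

lemma sum_sign_balanced:
  assumes "is_balanced n f"
  shows "(\<Sum>x\<in>bits n. bsign (f x) :: real) = 0"
proof -
  have n: "2 * 2 ^ (n - 1) = (2 ^ n :: real)"
    using assms by (cases n) (auto simp: is_balanced_def)
  \<comment> \<open>Writing signs through the indicator of \<open>f\<close> turns the sum into a
    count.\<close>
  have "(\<Sum>x\<in>bits n. bsign (f x) :: real) = (\<Sum>x\<in>bits n. 1 - 2 * of_bool (f x))"
    by (intro sum.cong) (auto simp: bsign_def)
  also have "\<dots> = 2 ^ n - 2 * real (card {x \<in> bits n. f x})"
    by (simp add: sum_subtractf card_bits finite_bits Int_def flip: sum_distrib_left)
  also have "\<dots> = 0"
    using assms n by (simp add: is_balanced_def)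
  finally show ?thesis .
qed


section \<open>The machine computing the entries\<close>

text \<open>
  Tapes: \<open>y\<close>, \<open>x\<close>, \<open>1\<^sup>k\<close>, numerator of the real part, numerator of the imaginary part. State \<open>0\<close>
  queries \<open>f y\<close>. In the states \<open>1\<close> to \<open>4\<close> the machine reads \<open>y\<close> and \<open>x\<close>, maintaining the sign of
  the entry and the parity of the position; the third head advances on every other step and so
  ends at distance \<open>(n + 1) div 2\<close>. States \<open>5\<close> and \<open>6\<close> write one zero per remaining cell of the
  third tape and then the leading one; in state \<open>5\<close>, where \<open>n\<close> is even, the last tape stays blank.
\<close>

definition read_state :: "bool \<Rightarrow> bool \<Rightarrow> nat" where
  "read_state p r = 1 + of_bool p + 2 * of_bool r"

definition entry_delta :: "nat \<Rightarrow> symbol list \<Rightarrow> action" where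
  "entry_delta s as =
     (if s = 0 then Ask 0 (read_state True False) (read_state False False)
      else if s < 5 then
        (let p = even s; r = 2 < s in
         if as ! 0 \<noteq> None then
           Act (read_state (p \<noteq> (as ! 0 = Some True \<and> as ! 1 = Some True)) (\<not> r))
             [(as ! 0, MoveR), (as ! 1, MoveR), (as ! 2, if r then Stay else MoveR),
              (as ! 3, Stay), (as ! 4, Stay)]
         else
           Act (5 + of_bool r)
             [(as ! 0, Stay), (as ! 1, Stay), (as ! 2, Stay),
              (Some p, MoveR), if r then (Some p, MoveR) else (as ! 4, Stay)])
      else if s < 7 then
        (let b = Some (as ! 2 = None) in
         Act (if as ! 2 = None then 7 else s)
           [(as ! 0, Stay), (as ! 1, Stay), (as ! 2, MoveR),
            (b, MoveR), if s = 6 then (b, MoveR) else (as ! 4, Stay)])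
      else Halt)"

definition entry_machine :: machine where
  "entry_machine = \<lparr>num_tapes = 5, num_states = 8, delta = entry_delta\<rparr>"

lemma well_formed_entry_machine: "well_formed entry_machine"
  by (simp add: well_formed_def entry_machine_def entry_delta_def read_state_def Let_def)

text \<open>These are the tests by which \<open>entry_delta\<close> decodes the sign and the parity
  from a state.\<close>

lemma read_state_simps [simp]:
  "0 < read_state p r" "read_state p r < 5" "even (read_state p r) \<longleftrightarrow> p"
  "2 < read_state p r \<longleftrightarrow> r"
  by (auto simp: read_state_def)

lemma step_read:
  assumes "i < length y" "i < length x"
  shows "step entry_machine f
      (read_state p r, [tape_of y i, tape_of x i, tape_of u h, tape_of [] 0, tape_of [] 0], q)
    = (read_state (p \<noteq> (y ! i \<and> x ! i)) (\<not> r),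
       [tape_of y (Suc i), tape_of x (Suc i), tape_of u (if r then h else Suc h),
        tape_of [] 0, tape_of [] 0], q)"
  using assms by (simp add: entry_machine_def entry_delta_def Let_def write_move_keep)

text \<open>Loop invariant. The third head moves on steps from even positions, so
  \<open>(j + 1) div 2\<close> times, possibly into the blanks beyond \<open>u\<close>.\<close>

lemma run_read:
  assumes "length y = n" "length x = n"
  shows "j \<le> n \<Longrightarrow> (step entry_machine f ^^ j)
      (read_state p False, [tape_of y 0, tape_of x 0, tape_of u 0, tape_of [] 0, tape_of [] 0], q)
    = (read_state (p \<noteq> dot (take j y) (take j x)) (odd j),
       [tape_of y j, tape_of x j, tape_of u ((j + 1) div 2), tape_of [] 0, tape_of [] 0], q)"
proof (induction j)
  case (Suc j)
  have "dot (take (Suc j) y) (take (Suc j) x) = (dot (take j y) (take j x) \<noteq> (y ! j \<and> x ! j))"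
    using Suc.prems assms by (simp add: take_Suc_conv_app_nth dot_snoc)
  then have "(p \<noteq> dot (take j y) (take j x)) \<noteq> (y ! j \<and> x ! j)
      \<longleftrightarrow> p \<noteq> dot (take (Suc j) y) (take (Suc j) x)"
    by blast
  moreover have "(if odd j then (j + 1) div 2 else Suc ((j + 1) div 2)) = (Suc j + 1) div 2"
    by presburger
  moreover have "(\<not> odd j) = odd (Suc j)"
    by simp
  ultimately show ?case
    using Suc assms by (simp only: funpow.simps o_apply Suc_leD step_read Suc_le_lessD)
qed simp

text \<open>The bound means \<open>m + j \<le> k\<close> or \<open>j = 0\<close>; the latter covers
  a third head that is already past the unary precision.\<close>

lemma run_write:
  "m + j \<le> max m k \<Longrightarrow> (step entry_machine f ^^ j)
      (5 + of_bool r, [tape_of y a, tape_of x b, tape_of (replicate k True) m,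
         tape_of [p] 1, if r then tape_of [p] 1 else tape_of [] 0], q)
    = (5 + of_bool r, [tape_of y a, tape_of x b, tape_of (replicate k True) (m + j),
         tape_of (p # replicate j False) (Suc j),
         if r then tape_of (p # replicate j False) (Suc j) else tape_of [] 0], q)"
proof (induction j)
  case (Suc j)
  then have "m + j < k" "m + j \<le> max m k"
    by auto
  with Suc.IH show ?case
    by (cases r) (simp_all add: entry_machine_def entry_delta_def Let_def write_move_keep
        write_move_append replicate_append_same)
qed simp

text \<open>The magnitude is a power of two with the leading one last; for large \<open>k\<close>,
  dividing by \<open>2 ^ k\<close> gives exactly \<open>1 / 2 ^ ((n + 1) div 2)\<close>.\<close>

definition numerator :: "bool \<Rightarrow> nat \<Rightarrow> nat \<Rightarrow> bool list" where
  "numerator p n k = p # replicate (k - (n + 1) div 2) False @ [True]"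

lemma computes_entry_machine:
  fixes f :: "bool list \<Rightarrow> bool"
  assumes "length y = n" "length x = n"
  defines "p \<equiv> f y \<noteq> dot y x"
  shows "computes entry_machine f [y, x, replicate k True]
    [numerator p n k, if odd n then numerator p n k else []]
    (n + (k - (n + 1) div 2) + 3) 1"
proof -
  define m where "m = (n + 1) div 2"
  define u where "u = replicate k True"
  let ?run = "\<lambda>t. step entry_machine f ^^ t"
  let ?c1 = "(read_state (f y) False,
    [tape_of y 0, tape_of x 0, tape_of u 0, tape_of [] 0, tape_of [] 0], 1 :: nat)"
  let ?c2 = "(read_state p (odd n),
    [tape_of y n, tape_of x n, tape_of u m, tape_of [] 0, tape_of [] 0], 1 :: nat)"
  let ?c3 = "(5 + of_bool (odd n), [tape_of y n, tape_of x n, tape_of u m, tape_of [p] 1,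
    if odd n then tape_of [p] 1 else tape_of [] 0], 1 :: nat)"
  let ?z = "tape_of (p # replicate (k - m) False) (Suc (k - m))"
  let ?c4 = "(5 + of_bool (odd n), [tape_of y n, tape_of x n, tape_of u (m + (k - m)), ?z,
    if odd n then ?z else tape_of [] 0], 1 :: nat)"
  let ?v = "tape_of (numerator p n k) (k - m + 2)"
  let ?c5 = "(7, [tape_of y n, tape_of x n, tape_of u (m + (k - m) + 1), ?v,
    if odd n then ?v else tape_of [] 0], 1 :: nat)"
  have s1: "?run 1 (0, [tape_of y 0, tape_of x 0, tape_of u 0, tape_of [] 0, tape_of [] 0], 0) = ?c1"
    by (simp add: entry_machine_def entry_delta_def)
  have s2: "?run n ?c1 = ?c2"
    using run_read[OF assms(1,2) order.refl] assms(1,2) by (simp add: p_def m_def)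
  have s3: "?run 1 ?c2 = ?c3"
    using assms(1,2)
    by (simp add: entry_machine_def entry_delta_def Let_def write_move_keep write_move_append)
  have s4: "?run (k - m) ?c3 = ?c4"
    unfolding u_def by (rule run_write) simp
  have num: "numerator p n k = (p # replicate (k - m) False) @ [True]"
    by (simp add: numerator_def m_def)
  \<comment> \<open>The third head now scans a blank, which triggers the leading one and the halting
    state.\<close>
  have "\<not> m + (k - m) < k"
    by simp
  then have s5: "?run 1 ?c4 = ?c5"
    by (simp add: entry_machine_def entry_delta_def Let_def write_move_keep write_move_append u_def
        num)
  \<comment> \<open>Query, reading loop, sign, zeros, leading one.\<close>
  have "?run (1 + n + 1 + (k - m) + 1)
      (0, [tape_of y 0, tape_of x 0, tape_of u 0, tape_of [] 0, tape_of [] 0], 0) = ?c5"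
    using s1 s2 s3 s4 s5 by (intro funpow_step_append)
  moreover have "1 + n + 1 + (k - m) + 1 = n + (k - m) + 3"
    by simp
  ultimately have "?run (n + (k - m) + 3)
      (0, [tape_of y 0, tape_of x 0, tape_of u 0, tape_of [] 0, tape_of [] 0], 0) = ?c5"
    by metis
  moreover have "num_tapes entry_machine = 5"
    by (simp add: entry_machine_def)
  moreover have "delta entry_machine 7 as = Halt" for as
    by (simp add: entry_machine_def entry_delta_def)
  moreover have "replicate 2 (tape_of [] 0) = [tape_of [] 0, tape_of [] 0]"
    by (simp add: numeral_2_eq_2)
  ultimately show ?thesis
    unfolding m_def[symmetric] u_def[symmetric]
    by (cases "odd n") (simp_all add: computes_def load_eq_tape_of)
qed

section \<open>Accuracy of the output numerators\<close>

lemma signed_int_numerator: "signed_int (numerator p n k) = bsign p * 2 ^ (k - (n + 1) div 2)"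
proof -
  have "horner_sum of_bool 2 (replicate j False @ [True]) = (2 ^ j :: int)" for j
    by (induction j) simp_all
  then show ?thesis
    by (simp add: numerator_def bsign_def)
qed

text \<open>For \<open>k < m\<close> the truncated exponent makes the numerator \<open>\<plusminus>1\<close>, which is still precise enough.\<close>

lemma numerator_approx:
  "\<bar>bsign p / 2 ^ m - bsign p * 2 ^ (k - m) / 2 ^ k\<bar> \<le> (1 / 2 ^ k :: real)"
proof (cases "m \<le> k")
  case True
  then have "(2 :: real) ^ (k - m) / 2 ^ k = 1 / 2 ^ m"
    by (simp add: power_diff)
  then have "bsign p * 2 ^ (k - m) / 2 ^ k = (bsign p / 2 ^ m :: real)"
    by (simp only: times_divide_eq_right[symmetric]) simp
  then show ?thesis
    by simp
next
  case False
  \<comment> \<open>Both numbers have the same sign and modulus at most \<open>1 / 2 ^ k\<close>,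
    hence so has their difference.\<close>
  then have "(1 :: real) / 2 ^ m \<le> 1 / 2 ^ k"
    by (intro divide_left_mono power_increasing) auto
  moreover have "(0 :: real) < 1 / 2 ^ m"
    by simp
  ultimately show ?thesis
    using False by (simp add: bsign_def)
qed

lemma computes_entries_dj_mat: "computes_entries entry_machine [:3, 1:] n f (dj_mat n f)"
  unfolding computes_entries_def
proof (intro ballI allI)
  fix y x k assume yx: "y \<in> bits n" "x \<in> bits n"
  define p where "p = (f y \<noteq> dot y x)"
  define m where "m = (n + 1) div 2"
  let ?a = "numerator p n k"
  \<comment> \<open>For even \<open>n\<close> the blank tape decodes to 0, the exact imaginary
    part.\<close>
  let ?b = "if odd n then numerator p n k else []"
  let ?t = "n + (k - m) + 3"
  have "computes entry_machine f [y, x, replicate k True] [?a, ?b] ?t 1"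
    unfolding p_def m_def by (rule computes_entry_machine) (use yx in \<open>simp_all add: bits_def\<close>)
  moreover have "?t \<le> poly [:3, 1:] (n + k)"
    by simp
  moreover have "Re (entry y (dj_mat n f) x) = bsign p / 2 ^ m"
    and "Im (entry y (dj_mat n f) x) = (if odd n then bsign p / 2 ^ m else 0)"
    unfolding entry_dj_mat[OF yx] p_def[symmetric] m_def
    by (simp_all add: bsign_def Re_amp Im_amp)
  moreover have "real_of_int (signed_int ?a) = bsign p * 2 ^ (k - m)"
    by (simp add: signed_int_numerator bsign_def m_def)
  ultimately show "\<exists>a b. \<exists>t\<le>poly [:3, 1:] (n + k).
      computes entry_machine f [y, x, replicate k True] [a, b] t 1 \<and>
      \<bar>Re (entry y (dj_mat n f) x) - of_int (signed_int a) / 2 ^ k\<bar> \<le> 1 / 2 ^ k \<and>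
      \<bar>Im (entry y (dj_mat n f) x) - of_int (signed_int b) / 2 ^ k\<bar> \<le> 1 / 2 ^ k"
    using numerator_approx[of p m k]
    by (intro exI[of _ ?a] exI[of _ ?b] exI[of _ ?t]) auto
qed

theorem theorem1:
  shows "\<exists>(M :: machine) (p :: nat poly) (I :: nat \<Rightarrow> bool list) (A :: nat \<Rightarrow> bool list set).
    well_formed M \<and>
    poly_time_strings I \<and> (\<forall>n. I n \<in> bits n) \<and>
    poly_time_sets A \<and> (\<forall>n. A n \<subseteq> bits n) \<and>
    (\<forall>(n :: nat) (f :: bool list \<Rightarrow> bool). is_constant n f \<or> is_balanced n f \<longrightarrow>
      (\<exists>T :: complex mat.
        unitary (2 ^ n) T \<and>
        computes_entries M p n f T \<and>
        (is_constant n f \<longrightarrow> (\<Sum>c\<in>A n. (cmod (entry c (T ^\<^sub>m 2) (I n)))\<^sup>2) \<ge> 2 / 3) \<and>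
        (is_balanced n f \<longrightarrow> (\<Sum>c\<in>A n. (cmod (entry c (T ^\<^sub>m 2) (I n)))\<^sup>2) \<le> 1 / 3)))"
proof (intro exI[of _ entry_machine] exI[of _ "[:3, 1:]"] exI[of _ "\<lambda>n. replicate n False"]
    exI[of _ "\<lambda>n. {replicate n False}"] conjI allI impI)
  fix n f
  show "\<exists>T. unitary (2 ^ n) T \<and> computes_entries entry_machine [:3, 1:] n f T \<and>
      (is_constant n f \<longrightarrow> (\<Sum>c\<in>{replicate n False}.
        (cmod (entry c (T ^\<^sub>m 2) (replicate n False)))\<^sup>2) \<ge> 2 / 3) \<and>
      (is_balanced n f \<longrightarrow> (\<Sum>c\<in>{replicate n False}.
        (cmod (entry c (T ^\<^sub>m 2) (replicate n False)))\<^sup>2) \<le> 1 / 3)"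
    \<comment> \<open>The single summand is 1 for constant \<open>f\<close> and 0 for balanced
      \<open>f\<close>.\<close>
    using unitary_dj_mat[of n f] computes_entries_dj_mat[of n f]
    by (intro exI[of _ "dj_mat n f"])
       (simp add: cmod_entry_dj_mat_squared
          sum_sign_constant sum_sign_balanced power_divide)
qed (simp_all add: well_formed_entry_machine poly_time_strings_zeros poly_time_sets_zeros bits_def)

end
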